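(* Let $r\geq 1$ and $k\geq 2$ be integers, and let $\ell_0=\left\lceil \max\left\{\sqrt{\tfrac{k}{2}+1},\ \tfrac{k-1}{r}+2\right\}\right\rceil$. Then for every integer $\ell\geq \ell_0^2$, $rc_k(K_{\ell[r]})=2$.
   Context: For integers $m\geq 1$ and $r\geq 1$, $K_{m[r]}$ denotes the complete $m$-partite graph in which each of the $m$ parts has exactly $r$ vertices. In an edge-colored graph (adjacent edges may receive the same color), a path is rainbow if no two of its edges have the same color. For a $\kappa$-connected graph $G$ and an integer $k$ with $1\leq k\leq\kappa$, the rainbow $k$-connectivity $rc_k(G)$ is the minimum integer $j$ such that there is an edge-coloring of $G$ with $j$ colors in which every two distinct vertices $u,v$ are connected by at least $k$ internally disjoint rainbow $u$–$v$ paths. *)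

theory Defs
  imports Complex_Main "HOL-Library.Extended_Nat"
begin

text \<open>A simple undirected graph is given by its vertex set \<open>V\<close> and its set \<open>E\<close> of
  edges, each edge being a two-element subset of \<open>V\<close>. A path is the list of its vertices.\<close>

definition path_edges :: "'a list \<Rightarrow> 'a set list" where
  "path_edges p = map (\<lambda>(x, y). {x, y}) (zip p (tl p))"

definition is_path :: "'a set \<Rightarrow> 'a set set \<Rightarrow> 'a \<Rightarrow> 'a \<Rightarrow> 'a list \<Rightarrow> bool" where
  "is_path V E u v p \<longleftrightarrow>
     p \<noteq> [] \<and> distinct p \<and> set p \<subseteq> V \<and> set (path_edges p) \<subseteq> E \<and> hd p = u \<and> last p = v"

definition rainbow :: "('a set \<Rightarrow> nat) \<Rightarrow> 'a list \<Rightarrow> bool" where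
  "rainbow c p \<longleftrightarrow> distinct (map c (path_edges p))"

definition interior_vertices :: "'a list \<Rightarrow> 'a set" where
  "interior_vertices p = set p - {hd p, last p}"

definition internally_disjoint :: "'a list set \<Rightarrow> bool" where
  "internally_disjoint P \<longleftrightarrow>
     (\<forall>p\<in>P. \<forall>q\<in>P. p \<noteq> q \<longrightarrow> interior_vertices p \<inter> interior_vertices q = {})"

text \<open>In the next definition \<open>P\<close> is a set, so the \<open>k\<close> paths are distinct; in particular
  the single-edge path between adjacent vertices is counted once.\<close>

definition rainbow_k_connected ::
    "nat \<Rightarrow> 'a set \<Rightarrow> 'a set set \<Rightarrow> ('a set \<Rightarrow> nat) \<Rightarrow> bool" where
  "rainbow_k_connected k V E c \<longleftrightarrow>
     (\<forall>u\<in>V. \<forall>v\<in>V. u \<noteq> v \<longrightarrow>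
       (\<exists>P. finite P \<and> k \<le> card P \<and>
            (\<forall>p\<in>P. is_path V E u v p \<and> rainbow c p) \<and> internally_disjoint P))"

text \<open>The minimum is taken in \<^typ>\<open>enat\<close>: for a finite graph it is \<open>\<infinity>\<close> only when \<open>k\<close> exceeds the
  connectivity, as then no colouring has the required property. A finite
  value is always attained. Colours need not all be used; this does not affect the minimum.\<close>

definition rainbow_connectivity :: "nat \<Rightarrow> 'a set \<Rightarrow> 'a set set \<Rightarrow> enat" where
  "rainbow_connectivity k V E =
     Inf (enat ` {j. \<exists>c. c ` E \<subseteq> {..<j} \<and> rainbow_k_connected k V E c})"

text \<open>The vertex \<open>(i, x)\<close> is the \<open>x\<close>-th vertex of the \<open>i\<close>-th part.\<close>

definition multipartite_verts :: "nat \<Rightarrow> nat \<Rightarrow> (nat \<times> nat) set" where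
  "multipartite_verts m r = {..<m} \<times> {..<r}"

definition multipartite_edges :: "nat \<Rightarrow> nat \<Rightarrow> (nat \<times> nat) set set" where
  "multipartite_edges m r =
     {{u, v} | u v. u \<in> multipartite_verts m r \<and> v \<in> multipartite_verts m r \<and> fst u \<noteq> fst v}"

end

theory Submission
  imports Defs
begin

text \<open>Place the parts in rows of \<open>n = l0\<close> cells (the last row may be incomplete) and call two
  parts related if they share a row or a column. For any two distinct parts, at least \<open>n - 2\<close>
  further parts are related to exactly one of them, and at least \<open>n - 2\<close> are related to both or to
  neither. Colour the edge between \<open>(i, x)\<close> and \<open>(j, y)\<close> by the truth value of
  ``\<open>i\<close>, \<open>j\<close> are related iff \<open>x = y\<close>''. A vertex \<open>(m, z)\<close> is the midpoint of a rainbow path between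
  vertices of different parts \<open>i\<close>, \<open>j\<close> in at least \<open>n - 2\<close> cases for every \<open>z\<close>: the parts \<open>m\<close>
  distinguishing \<open>i\<close> from \<open>j\<close> or those not distinguishing them, depending on \<open>z\<close>. This gives
  \<open>r (n - 2) \<ge> k - 1\<close> paths besides the edge itself. Two vertices \<open>(i, x)\<close>, \<open>(i, y)\<close>
  of one part are joined through all \<open>(m, x)\<close> and \<open>(m, y)\<close> with \<open>m \<noteq> i\<close>, which gives
  \<open>2 (l - 1) \<ge> k\<close> paths.\<close>

section \<open>Counting cells of the grid of parts\<close>

definition rook :: "nat \<Rightarrow> nat \<Rightarrow> nat \<Rightarrow> bool" where
  "rook n i j \<longleftrightarrow> i mod n = j mod n \<or> i div n = j div n"

lemma rook_commute: "rook n i j \<longleftrightarrow> rook n j i"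
  by (auto simp: rook_def)

text \<open>Since \<open>n\<^sup>2 \<le> l\<close>, the first \<open>n\<close> rows are complete, so
  column \<open>a\<close> has a cell \<open>s * n + a\<close> in each of them. Excluding rows
  \<open>p\<close> and \<open>q\<close> removes at most two of these \<open>n\<close> cells.\<close>

lemma card_column_minus_rows:
  fixes n l a p q :: nat
  assumes "n\<^sup>2 \<le> l" "a < n"
  shows "n - 2 \<le> card {m. m < l \<and> m mod n = a \<and> m div n \<noteq> p \<and> m div n \<noteq> q}" (is "_ \<le> card ?C")
proof -
  have "(\<lambda>s. s * n + a) ` ({..<n} - {p, q}) \<subseteq> ?C"
  proof (rule image_subsetI)
    fix s assume s: "s \<in> {..<n} - {p, q}"
    have "Suc s * n \<le> n * n"
      using s by (intro mult_right_mono) auto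
    then have "s * n + a < l"
      using assms by (simp add: power2_eq_square)
    moreover have "(s * n + a) mod n = a" "(s * n + a) div n = s"
      using assms by auto
    ultimately show "s * n + a \<in> ?C"
      using s by auto
  qed
  then have "card ((\<lambda>s. s * n + a) ` ({..<n} - {p, q})) \<le> card ?C"
    by (intro card_mono) auto
  moreover have "inj_on (\<lambda>s. s * n + a) ({..<n} - {p, q})"
    using assms by (auto simp: inj_on_def)
  moreover have "n - 2 \<le> card ({..<n} - {p, q})"
    using diff_card_le_card_Diff[of "{p, q}" "{..<n}"] card_insert_le_m1[of 2 "{q}" p] by simp
  ultimately show ?thesis
    by (simp add: card_image)
qed

lemma card_row_minus_cell:
  fixes n l a p :: nat
  assumes "Suc p * n \<le> l" "a < n"
  shows "n - 1 \<le> card {m. m < l \<and> m div n = p \<and> m mod n \<noteq> a}" (is "_ \<le> card ?C")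
proof -
  have "(\<lambda>b. p * n + b) ` ({..<n} - {a}) \<subseteq> ?C"
    using assms by auto
  then have "card ((\<lambda>b. p * n + b) ` ({..<n} - {a})) \<le> card ?C"
    by (intro card_mono) auto
  moreover have "card ((\<lambda>b. p * n + b) ` ({..<n} - {a})) = n - 1"
    using assms by (subst card_image) (auto simp: inj_on_def)
  ultimately show ?thesis by simp
qed

text \<open>If the columns differ, a cell in the column of \<open>i\<close> outside both rows is
  related to \<open>i\<close> only. If the columns agree, the rows differ, and a cell in one of
  these rows outside the common column is related only to the part in that row.\<close>

lemma rook_distinguishing:
  assumes "n\<^sup>2 \<le> l" "i < l" "j < l" "i \<noteq> j" "n > 0"
  shows "n - 2 \<le> card {m. m < l \<and> m \<noteq> i \<and> m \<noteq> j \<and> rook n i m \<noteq> rook n j m}"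
    (is "_ \<le> card ?D")
proof (cases "i mod n = j mod n")
  case False
  have "{m. m < l \<and> m mod n = i mod n \<and> m div n \<noteq> i div n \<and> m div n \<noteq> j div n} \<subseteq> ?D"
    unfolding rook_def using False by (intro Collect_mono impI) metis
  then have "card {m. m < l \<and> m mod n = i mod n \<and> m div n \<noteq> i div n \<and> m div n \<noteq> j div n} \<le> card ?D"
    by (intro card_mono) auto
  then show ?thesis
    using card_column_minus_rows[OF assms(1), of "i mod n" "i div n" "j div n"] \<open>n > 0\<close>
    by (meson le_trans mod_less_divisor)
next
  case True
  \<comment> \<open>Use the upper of the two rows, which is complete.\<close>
  define p where "p = min (i div n) (j div n)"
  define q where "q = max (i div n) (j div n)"
  have ne: "i div n \<noteq> j div n"
    using True \<open>i \<noteq> j\<close> div_mult_mod_eq[of i n] div_mult_mod_eq[of j n] by auto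
  then have "Suc p \<le> q"
    by (auto simp: p_def q_def)
  \<comment> \<open>Row \<open>p\<close> ends before row \<open>q\<close> begins, and row
    \<open>q\<close> contains \<open>i\<close> or \<open>j\<close>, hence begins at an index at most
    \<open>max i j\<close>.\<close>
  then have "Suc p * n \<le> q * n"
    by (rule mult_right_mono) simp
  also have "q * n \<le> max i j"
    by (cases "i div n \<le> j div n") (simp_all add: q_def le_max_iff_disj)
  also have "max i j \<le> l"
    using assms by auto
  finally have "n - 1 \<le> card {m. m < l \<and> m div n = p \<and> m mod n \<noteq> i mod n}"
    using \<open>n > 0\<close> by (intro card_row_minus_cell) auto
  moreover have "p = i div n \<and> p \<noteq> j div n \<or> p = j div n \<and> p \<noteq> i div n"
    using ne by (auto simp: p_def min_def)
  then have "{m. m < l \<and> m div n = p \<and> m mod n \<noteq> i mod n} \<subseteq> ?D"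
    unfolding rook_def using True by (intro Collect_mono impI) metis
  then have "card {m. m < l \<and> m div n = p \<and> m mod n \<noteq> i mod n} \<le> card ?D"
    by (intro card_mono) auto
  ultimately show ?thesis by simp
qed

text \<open>Outside the rows of \<open>i\<close> and \<open>j\<close>, the cells of a common column
  are related to both, and those of a column containing neither are related to neither. If the
  columns differ, \<open>n \<ge> 3\<close> leaves a third one.\<close>

lemma rook_agreeing:
  assumes "n\<^sup>2 \<le> l" "n \<ge> 3"
  shows "n - 2 \<le> card {m. m < l \<and> m \<noteq> i \<and> m \<noteq> j \<and> rook n i m = rook n j m}"
    (is "_ \<le> card ?A")
proof -
  obtain a where a: "a < n" "(i mod n = a) = (j mod n = a)"
  proof (cases "i mod n = j mod n")
    case True
    then show ?thesis using that[of "i mod n"] assms by simp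
  next
    case False
    have "\<not> {..<n} \<subseteq> {i mod n, j mod n}"
      using card_mono[of "{i mod n, j mod n}" "{..<n}"] card_insert_le_m1[of 2 "{j mod n}" "i mod n"] assms
      by auto
    then show ?thesis using that by auto
  qed
  have "{m. m < l \<and> m mod n = a \<and> m div n \<noteq> i div n \<and> m div n \<noteq> j div n} \<subseteq> ?A"
    unfolding rook_def using a by (intro Collect_mono impI) metis
  then have "card {m. m < l \<and> m mod n = a \<and> m div n \<noteq> i div n \<and> m div n \<noteq> j div n} \<le> card ?A"
    by (intro card_mono) auto
  then show ?thesis
    using card_column_minus_rows[OF assms(1) a(1)] le_trans by blast
qed

section \<open>The 2-colouring and its rainbow paths\<close>

definition rook_vertex_rel :: "nat \<Rightarrow> nat \<times> nat \<Rightarrow> nat \<times> nat \<Rightarrow> bool" where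
  "rook_vertex_rel n u v \<longleftrightarrow> (rook n (fst u) (fst v) \<longleftrightarrow> snd u = snd v)"

definition rook_coloring :: "nat \<Rightarrow> (nat \<times> nat) set \<Rightarrow> nat" where
  "rook_coloring n e = of_bool (\<exists>u v. e = {u, v} \<and> rook_vertex_rel n u v)"

text \<open>An edge is an unordered pair; symmetry of \<open>rook_vertex_rel\<close> makes its
  colour independent of the order in which the ends are read.\<close>

lemma rook_coloring_edge: "rook_coloring n {u, v} = of_bool (rook_vertex_rel n u v)"
proof -
  have "rook_vertex_rel n u v = rook_vertex_rel n v u"
    unfolding rook_vertex_rel_def by (metis rook_commute)
  then have "(\<exists>a b. {u, v} = {a, b} \<and> rook_vertex_rel n a b) = rook_vertex_rel n u v"
    unfolding doubleton_eq_iff by blast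
  then show ?thesis
    by (simp only: rook_coloring_def)
qed

lemma rook_coloring_less_2: "rook_coloring n e < 2"
  by (simp add: rook_coloring_def)

text \<open>A pair of nonadjacent vertices is covered by the case \<open>d = {}\<close>, a pair of adjacent ones by
  \<open>d = {[u, v]}\<close>.\<close>

lemma internally_disjoint_short_paths:
  assumes "d \<subseteq> {[u, v]}"
  shows "internally_disjoint ((\<lambda>w. [u, w, v]) ` W \<union> d)"
  using assms by (auto simp: internally_disjoint_def interior_vertices_def)

text \<open>Both ends lie in part \<open>i\<close>, so \<open>rook\<close> takes the same value on
  the two edges at \<open>w\<close>, while exactly one end shares its second coordinate with
  \<open>w\<close>. Hence the colours differ.\<close>

lemma rook_same_part_midpoints:
  assumes "i < l" "x < r" "y < r" "x \<noteq> y"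
  shows "\<exists>W \<subseteq> multipartite_verts l r. card W = 2 * (l - 1) \<and>
    (\<forall>w\<in>W. fst w \<noteq> i \<and> rook_coloring n {(i, x), w} \<noteq> rook_coloring n {w, (i, y)})"
proof (intro exI conjI)
  let ?W = "({..<l} - {i}) \<times> {x, y}"
  show "?W \<subseteq> multipartite_verts l r"
    using assms by (auto simp: multipartite_verts_def)
  show "card ?W = 2 * (l - 1)"
    using assms by (simp add: card_cartesian_product)
  have "rook n m i = rook n i m" for m
    by (rule rook_commute)
  then show "\<forall>w\<in>?W. fst w \<noteq> i \<and> rook_coloring n {(i, x), w} \<noteq> rook_coloring n {w, (i, y)}"
    using assms by (auto simp: rook_coloring_edge rook_vertex_rel_def)
qed

lemma rook_different_parts_midpoints:
  assumes "n\<^sup>2 \<le> l" "n \<ge> 3" "i < l" "j < l" "i \<noteq> j"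
  shows "\<exists>W \<subseteq> multipartite_verts l r. r * (n - 2) \<le> card W \<and>
    (\<forall>w\<in>W. fst w \<noteq> i \<and> fst w \<noteq> j \<and>
      rook_coloring n {(i, x), w} \<noteq> rook_coloring n {w, (j, y)})"
proof (intro exI conjI)
  define M where "M z = {m. m < l \<and> m \<noteq> i \<and> m \<noteq> j \<and>
    (rook n i m \<longleftrightarrow> x = z) \<noteq> (rook n j m \<longleftrightarrow> y = z)}" for z
  \<comment> \<open>The sum is indexed by \<open>z\<close> first, whereas a vertex has its part
    first; hence the swap.\<close>
  let ?W = "prod.swap ` (SIGMA z:{..<r}. M z)"
  have "n - 2 \<le> card (M z)" for z
  \<comment> \<open>When \<open>z\<close> equals both or neither of \<open>x\<close>,
    \<open>y\<close>, the colours differ iff \<open>m\<close> distinguishes \<open>i\<close> from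
    \<open>j\<close>; when it equals exactly one, iff \<open>m\<close> does not.\<close>
  proof (cases "(x = z) = (y = z)")
    case True
    then have "M z = {m. m < l \<and> m \<noteq> i \<and> m \<noteq> j \<and> rook n i m \<noteq> rook n j m}"
      by (auto simp: M_def)
    then show ?thesis
      using rook_distinguishing[of n l i j] assms by simp
  next
    case False
    then have "M z = {m. m < l \<and> m \<noteq> i \<and> m \<noteq> j \<and> rook n i m = rook n j m}"
      by (auto simp: M_def)
    then show ?thesis
      using rook_agreeing[of n l i j] assms by simp
  qed
  then have "r * (n - 2) \<le> (\<Sum>z<r. card (M z))"
    using sum_bounded_below[of "{..<r}" "n - 2" "\<lambda>z. card (M z)"] by simp
  also have "\<dots> = card ?W"
    by (subst card_image) (auto simp: M_def card_SigmaI)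
  finally show "r * (n - 2) \<le> card ?W" .
  show "?W \<subseteq> multipartite_verts l r"
    by (auto simp: multipartite_verts_def M_def)
  have "rook n m j = rook n j m" for m
    by (rule rook_commute)
  then show "\<forall>w\<in>?W. fst w \<noteq> i \<and> fst w \<noteq> j \<and>
      rook_coloring n {(i, x), w} \<noteq> rook_coloring n {w, (j, y)}"
    by (auto simp: rook_coloring_edge rook_vertex_rel_def M_def)
qed

lemma multipartite_edge_iff:
  "{u, v} \<in> multipartite_edges m r \<longleftrightarrow>
     u \<in> multipartite_verts m r \<and> v \<in> multipartite_verts m r \<and> fst u \<noteq> fst v"
  unfolding multipartite_edges_def mem_Collect_eq doubleton_eq_iff by metis

lemma rook_coloring_rainbow_k_connected:
  assumes "n\<^sup>2 \<le> l" "n \<ge> 3" "k \<le> 2 * (l - 1)" "k \<le> r * (n - 2) + 1"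
  shows "rainbow_k_connected k (multipartite_verts l r) (multipartite_edges l r) (rook_coloring n)"
  unfolding rainbow_k_connected_def
proof (intro ballI impI)
  let ?V = "multipartite_verts l r" and ?E = "multipartite_edges l r"
  fix u v assume u: "u \<in> ?V" and v: "v \<in> ?V" and "u \<noteq> v"
  obtain i x j y where uv: "u = (i, x)" "v = (j, y)"
    by fastforce
  \<comment> \<open>\<open>W\<close> collects the midpoints of paths with two edges;
    \<open>d\<close> holds the single-edge path, available only between different parts.\<close>
  obtain W d where W: "W \<subseteq> ?V" "k \<le> card W + card d"
    "\<And>w. w \<in> W \<Longrightarrow> fst w \<noteq> i \<and> fst w \<noteq> j \<and> rook_coloring n {u, w} \<noteq> rook_coloring n {w, v}"
    and d: "d \<subseteq> {[u, v]}" "d \<noteq> {} \<Longrightarrow> i \<noteq> j"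
  proof (cases "i = j")
    case True
    then obtain W where "W \<subseteq> ?V" "card W = 2 * (l - 1)"
      "\<forall>w\<in>W. fst w \<noteq> i \<and> rook_coloring n {u, w} \<noteq> rook_coloring n {w, v}"
      using rook_same_part_midpoints[of i l x r y n] u v \<open>u \<noteq> v\<close>
      by (auto simp: uv multipartite_verts_def)
    then show ?thesis
      using that[of W "{}"] True assms by auto
  next
    case False
    then obtain W where "W \<subseteq> ?V" "r * (n - 2) \<le> card W"
      "\<forall>w\<in>W. fst w \<noteq> i \<and> fst w \<noteq> j \<and> rook_coloring n {u, w} \<noteq> rook_coloring n {w, v}"
      using rook_different_parts_midpoints[OF assms(1,2), of i j r x y] u v
      by (auto simp: uv multipartite_verts_def)
    then show ?thesis
      using that[of W "{[u, v]}"] False assms by auto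
  qed
  define P where "P = (\<lambda>w. [u, w, v]) ` W \<union> d"
  have "finite W"
    using W(1) by (rule finite_subset) (simp add: multipartite_verts_def)
  moreover have "finite d"
    using d(1) by (rule finite_subset) simp
  moreover have "(\<lambda>w. [u, w, v]) ` W \<inter> d = {}"
    using d(1) by auto
  ultimately have "finite P" "card P = card W + card d"
    by (auto simp: P_def card_Un_disjoint card_image inj_on_def)
  moreover have "is_path ?V ?E u v p \<and> rainbow (rook_coloring n) p" if p: "p \<in> P" for p
  proof -
    consider w where "w \<in> W" "p = [u, w, v]" | "p = [u, v]" "i \<noteq> j"
      using p d unfolding P_def by blast
    then show ?thesis
    proof cases
      case 1
      then have "w \<in> ?V" "fst u \<noteq> fst w" "fst w \<noteq> fst v"
        using W(1) W(3)[of w] by (auto simp: uv)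
      then show ?thesis
        using 1 W(3)[of w] u v \<open>u \<noteq> v\<close>
        by (auto simp: is_path_def rainbow_def path_edges_def multipartite_edge_iff)
    next
      case 2
      then show ?thesis
        using u v \<open>u \<noteq> v\<close>
        by (auto simp: is_path_def rainbow_def path_edges_def multipartite_edge_iff uv)
    qed
  qed
  moreover have "internally_disjoint P"
    unfolding P_def using d(1) by (rule internally_disjoint_short_paths)
  ultimately show "\<exists>P. finite P \<and> k \<le> card P \<and>
      (\<forall>p\<in>P. is_path ?V ?E u v p \<and> rainbow (rook_coloring n) p) \<and> internally_disjoint P"
    using W(2) by (intro exI[of _ P]) simp
qed

section \<open>The lower bound\<close>

lemma rainbow_path_length_le:
  assumes "is_path V E u v p" "rainbow c p" "c ` E \<subseteq> {..<j}"
  shows "length p \<le> Suc j"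
proof -
  have "set (map c (path_edges p)) \<subseteq> {..<j}"
    using assms by (auto simp: is_path_def)
  then have "card (set (map c (path_edges p))) \<le> j"
    using card_mono[of "{..<j}"] by fastforce
  then have "length (path_edges p) \<le> j"
    using assms(2) distinct_card[of "map c (path_edges p)"] by (simp add: rainbow_def)
  then show ?thesis
    by (simp add: path_edges_def)
qed

text \<open>With at most one colour a rainbow path has at most one edge, so \<open>[u, v]\<close> is
  the only candidate, but \<open>k \<ge> 2\<close> distinct paths are required.\<close>

lemma two_le_rainbow_connectivity:
  assumes "k \<ge> 2" "u \<in> V" "v \<in> V" "u \<noteq> v"
  shows "2 \<le> rainbow_connectivity k V E"
  unfolding rainbow_connectivity_def
proof (rule Inf_greatest, clarify)
  fix j c assume c: "c ` E \<subseteq> {..<j}" and conn: "rainbow_k_connected k V E c"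
  have "2 \<le> j"
  proof (rule ccontr)
    assume "\<not> 2 \<le> j"
    obtain P where P: "k \<le> card P" "\<forall>p\<in>P. is_path V E u v p \<and> rainbow c p"
      using conn assms unfolding rainbow_k_connected_def by blast
    have "p = [u, v]" if "p \<in> P" for p
    proof -
      have p: "is_path V E u v p"
        using P that by blast
      have "length p \<le> 2"
        using rainbow_path_length_le[OF p _ c] P(2) that \<open>\<not> 2 \<le> j\<close> by force
      then show ?thesis
        using p \<open>u \<noteq> v\<close>
        by (cases p; cases "tl p") (auto simp: is_path_def split: if_splits)
    qed
    then have "card P \<le> card {[u, v]}"
      by (intro card_mono) auto
    then show False
      using P(1) \<open>k \<ge> 2\<close> by simp
  qed
  then show "2 \<le> enat j"
    by (simp add: numeral_eq_enat)
qed

theorem theorem3: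
  fixes r k l :: nat and l0 :: int
  assumes "r \<ge> 1" and "k \<ge> 2"
    and "l0 = \<lceil>max (sqrt (real k / 2 + 1)) ((real k - 1) / real r + 2)\<rceil>"
    and "int l \<ge> l0 ^ 2"
  shows "rainbow_connectivity k (multipartite_verts l r) (multipartite_edges l r) = 2"
proof -
  have "max (sqrt (real k / 2 + 1)) ((real k - 1) / real r + 2) \<le> of_int l0"
    unfolding assms(3) by (rule le_of_int_ceiling)
  then have sqrt_le: "sqrt (real k / 2 + 1) \<le> of_int l0"
    and div_le: "(real k - 1) / real r + 2 \<le> of_int l0"
    by auto
  \<comment> \<open>Since \<open>k \<ge> 2\<close>, the second term of the maximum exceeds 2, which
    forces the integer \<open>l0\<close> to be at least 3.\<close>
  have "(real k - 1) / real r > 0"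
    using assms by simp
  then have "l0 \<ge> 3"
    using div_le by linarith
  define n where "n = nat l0"
  have l0: "l0 = int n" and "n \<ge> 3"
    using \<open>l0 \<ge> 3\<close> by (auto simp: n_def)
  have nl: "n\<^sup>2 \<le> l"
    using assms(4) by (simp add: l0 flip: of_nat_power)
  \<comment> \<open>The square root term serves pairs within one part: k/2 + 1 \<le> l rearranges to
    k \<le> 2(l - 1).\<close>
  have "real k / 2 + 1 \<le> (real n)\<^sup>2"
    using sqrt_le by (simp add: l0 real_sqrt_le_iff sqrt_le_D)
  also have "\<dots> \<le> real l"
    using nl by (simp flip: of_nat_power)
  finally have "k \<le> 2 * (l - 1)"
    by linarith
  \<comment> \<open>The other term serves pairs from different parts; the summand 1 is the edge
    joining them.\<close>
  moreover have "k \<le> r * (n - 2) + 1"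
  proof -
    have "real k - 1 \<le> real r * (real n - 2)"
      using div_le assms(1) by (simp add: l0 field_simps)
    also have "\<dots> = real (r * (n - 2))"
      using \<open>n \<ge> 3\<close> by (simp add: of_nat_diff)
    finally show ?thesis by linarith
  qed
  ultimately have "rainbow_k_connected k (multipartite_verts l r) (multipartite_edges l r)
      (rook_coloring n)"
    using rook_coloring_rainbow_k_connected nl \<open>n \<ge> 3\<close> by blast
  moreover have "rook_coloring n ` multipartite_edges l r \<subseteq> {..<2}"
    using rook_coloring_less_2 by auto
  ultimately have "rainbow_connectivity k (multipartite_verts l r) (multipartite_edges l r) \<le> enat 2"
    unfolding rainbow_connectivity_def by (intro Inf_lower imageI) auto
  moreover have "2 \<le> rainbow_connectivity k (multipartite_verts l r) (multipartite_edges l r)"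
  proof (rule two_le_rainbow_connectivity[OF assms(2)])
    have "(2::nat) \<le> n\<^sup>2"
      using \<open>n \<ge> 3\<close> power_mono[of 3 n 2] by simp
    then have "2 \<le> l"
      using nl by simp
    then show "(0, 0) \<in> multipartite_verts l r" "(1, 0) \<in> multipartite_verts l r"
      using assms(1) by (auto simp: multipartite_verts_def)
  qed simp
  ultimately show ?thesis
    by (simp add: numeral_eq_enat antisym)
qed

end
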